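(* The set $E\cup O$ consists of exactly the odd natural number solutions $m$ of the representation $$m=\Bigl(2^{a_{\kappa+1}}-\sum_{i=0}^{\kappa}2^{a_i}3^{\kappa-i}\Bigr)\Big/3^{\kappa+1},\qquad \kappa\in\mathbb{N}_0,\quad a_i\in\mathbb{N}_0,\quad 0\le a_0<a_1<\cdots<a_{\kappa+1}. \tag{R}$$ That is, an odd natural number $m$ can be written in the form (R) for some $\kappa$ and some exponents $a_0,\dots,a_{\kappa+1}$ if and only if $m\in E\cup O$, and every element of $E\cup O$ is an odd natural number. Here $E$ and $O$ are the sets defined as follows. For $k\in\mathbb{N}$, $b_0,b_1,\dots,b_{k+1}\in\mathbb{N}_0$, and $\upsilon_j\in\{1,2,\dots,2\cdot 3^{j}\}$ for $1\le j\le k$, put $$e_k=c+2b_0+\sum_{i=1}^{k+1}2b_i3^i+\sum_{i=1}^{k}\upsilon_i+1,\qquad o_k=c+2b_0+\sum_{i=1}^{k+1}2b_i3^i+\sum_{i=1}^{k}\upsilon_i+2.$$ Then $E$ is the set of all numbers $$\frac{2^{e_k}-3^{k+1}-3^k2^{2b_0+1}-\sum_{j=1}^{k}3^{k-j}2^{2b_0+\sum_{i=1}^{j}2b_i3^i+\sum_{i=1}^{j}\upsilon_i+1}}{3^{k+2}},$$ and $O$ is the set of all numbers $$\frac{2^{o_k}-3^{k+1}-3^k2^{2b_0+2}-\sum_{j=1}^{k}3^{k-j}2^{2b_0+\sum_{i=1}^{j}2b_i3^i+\sum_{i=1}^{j}\upsilon_i+2}}{3^{k+2}},$$ over all such $k$,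 $b_i$, $\upsilon_j$. In each formula, $c$ is the value, depending on the choice of $k,\upsilon_1,\dots,\upsilon_k$ and on whether the formula is the one for $E$ or the one for $O$, with $c\equiv 2$ or $4\pmod 6$ and $2\le c<2\cdot3^{k+1}$, for which the formula with $b_0=b_1=\cdots=b_{k+1}=0$ gives the smallest positive integer solution (the existence of such $c$ for every choice is part of the assertion).
   Context: $\mathbb{N}=\{1,2,3,\dots\}$ and $\mathbb{N}_0=\mathbb{N}\cup\{0\}$. The natural numbers of the form (R) are exactly the inverse iterates of $1$ under the Collatz function $f(x)=3x+1$ ($x$ odd), $f(x)=x/2$ ($x$ even). *)

theory Defs
  imports Complex_Main
begin

text \<open>The sequence \<open>a\<close> is only constrained, and only used, at the indices \<open>0, \<dots>, \<kappa> + 1\<close>.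
  The formula is evaluated in the reals, so neither the subtraction nor the division truncates.\<close>

definition R_form :: "nat \<Rightarrow> bool" where
  "R_form m \<longleftrightarrow> (\<exists>(\<kappa>::nat) (a::nat \<Rightarrow> nat). (\<forall>i\<le>\<kappa>. a i < a (i + 1)) \<and>
     real m = (2 ^ a (\<kappa> + 1) - (\<Sum>i = 0..\<kappa>. 2 ^ a i * 3 ^ (\<kappa> - i))) / 3 ^ (\<kappa> + 1))"

text \<open>The formulas for \<open>E\<close> and \<open>O\<close> differ only in one additive constant in the exponents of 2,
  which is the parameter \<open>r\<close>: \<open>r = 1\<close> for \<open>E\<close> and \<open>r = 2\<close> for \<open>O\<close>. Thus \<open>top_exp 1\<close>
  is \<open>e\<^sub>k\<close> and \<open>top_exp 2\<close> is \<open>o\<^sub>k\<close>.\<close>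

definition top_exp :: "nat \<Rightarrow> nat \<Rightarrow> (nat \<Rightarrow> nat) \<Rightarrow> (nat \<Rightarrow> nat) \<Rightarrow> nat \<Rightarrow> nat" where
  "top_exp r k \<upsilon> b c =
     c + 2 * b 0 + (\<Sum>i = 1..k + 1. 2 * b i * 3 ^ i) + (\<Sum>i = 1..k. \<upsilon> i) + r"

definition mid_exp :: "nat \<Rightarrow> (nat \<Rightarrow> nat) \<Rightarrow> (nat \<Rightarrow> nat) \<Rightarrow> nat \<Rightarrow> nat" where
  "mid_exp r \<upsilon> b j = 2 * b 0 + (\<Sum>i = 1..j. 2 * b i * 3 ^ i) + (\<Sum>i = 1..j. \<upsilon> i) + r"

definition sol :: "nat \<Rightarrow> nat \<Rightarrow> (nat \<Rightarrow> nat) \<Rightarrow> (nat \<Rightarrow> nat) \<Rightarrow> nat \<Rightarrow> real" where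
  "sol r k \<upsilon> b c =
     (2 ^ top_exp r k \<upsilon> b c - 3 ^ (k + 1) - 3 ^ k * 2 ^ (2 * b 0 + r)
        - (\<Sum>j = 1..k. 3 ^ (k - j) * 2 ^ mid_exp r \<upsilon> b j)) / 3 ^ (k + 2)"

definition admissible :: "nat \<Rightarrow> (nat \<Rightarrow> nat) \<Rightarrow> bool" where
  "admissible k \<upsilon> \<longleftrightarrow> 1 \<le> k \<and> (\<forall>j\<in>{1..k}. \<upsilon> j \<in> {1..2 * 3 ^ j})"

definition c_range :: "nat \<Rightarrow> nat set" where
  "c_range k = {c. (c mod 6 = 2 \<or> c mod 6 = 4) \<and> 2 \<le> c \<and> c < 2 * 3 ^ (k + 1)}"

text \<open>\<open>c\<close> is the value for which the formula with all \<open>b\<^sub>i = 0\<close> gives the smallest positive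
  integer, the competitors being all the \<open>c'\<close> in the prescribed range that give one.\<close>

definition is_c :: "nat \<Rightarrow> nat \<Rightarrow> (nat \<Rightarrow> nat) \<Rightarrow> nat \<Rightarrow> bool" where
  "is_c r k \<upsilon> = is_arg_min (\<lambda>c. sol r k \<upsilon> (\<lambda>_. 0) c)
     (\<lambda>c. c \<in> c_range k \<and> sol r k \<upsilon> (\<lambda>_. 0) c \<in> \<int> \<and> sol r k \<upsilon> (\<lambda>_. 0) c > 0)"

definition sol_set :: "nat \<Rightarrow> real set" where
  "sol_set r = {sol r k \<upsilon> b c |k \<upsilon> b c. admissible k \<upsilon> \<and> is_c r k \<upsilon> c}"

definition E_set :: "real set" where "E_set = sol_set 1"
definition O_set :: "real set" where "O_set = sol_set 2"

end

theory Submission imports Defs "HOL-Number_Theory.Residue_Primitive_Roots" begin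

text \<open>
  A solution of (R) is odd iff \<open>a\<^sub>0 = 0\<close>, and by appending cycles 1, 4, 2, 1 one may take
  \<open>\<kappa> = k + 1\<close> with \<open>k \<ge> 1\<close>. Division with remainder writes the gaps of the sequence \<open>a\<close> as
  \<open>2 b\<^sub>0 + r\<close> with \<open>r \<in> {1, 2}\<close>, then \<open>2 b\<^sub>j 3\<^sup>j + \<upsilon>\<^sub>j\<close>, and finally \<open>2 b\<^sub>k\<^sub>+\<^sub>1 3\<^sup>k\<^sup>+\<^sup>1 + c\<close>.
  Integrality of the solution depends only on the gaps \<open>a\<^sub>i\<^sub>+\<^sub>1 - a\<^sub>i\<close> modulo \<open>2 \<cdot> 3\<^sup>i\<close>, hence not on
  the \<open>b\<^sub>i\<close>. Since 2 is a primitive root modulo \<open>3\<^sup>k\<^sup>+\<^sup>2\<close>, exactly one \<open>c\<close> modulo \<open>2 \<cdot> 3\<^sup>k\<^sup>+\<^sup>1\<close> makes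
  it integral, and reduction modulo 9 gives \<open>c \<equiv> 2, 4 (mod 6)\<close>. An integral solution is
  automatically positive because the inverse Collatz steps lead from 1 to positive numbers only.
  So the minimality in the choice of \<open>c\<close> has only one competitor.
\<close>

section \<open>Powers of 2 modulo powers of 3\<close>

text \<open>2 has order 2 modulo 3, and \<open>2 ^ 2\<close> is not 1 modulo 9, which is the
  criterion for lifting a primitive root from 3 to all powers of 3.\<close>

lemma residue_primroot_2_power_3: "residue_primroot (3 ^ Suc n) (2::nat)"
proof -
  have "ord 3 (2::nat) dvd 2" "\<not> ord 3 (2::nat) dvd 1"
    unfolding ord_divides[symmetric] by (simp_all add: cong_def)
  hence "ord 3 (2::nat) = 2"
    using two_is_prime_nat unfolding prime_nat_iff by auto
  hence "residue_primroot 3 (2::nat)"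
    by (simp add: residue_primroot_def totient_prime)
  moreover have "[2 ^ 2 \<noteq> 1::nat] (mod 3\<^sup>2)"
    by (simp add: cong_def)
  ultimately show ?thesis
    using residue_primroot_prime_lift_iff[of 3 2] by (simp del: power_Suc)
qed

lemma totient_power_3: "totient (3 ^ Suc n) = 2 * 3 ^ n"
  by (subst totient_prime_power_Suc) auto

lemma cong_power_2_iff:
  "[2 ^ x = 2 ^ y :: int] (mod 3 ^ Suc n) \<longleftrightarrow> [x = y] (mod 2 * 3 ^ n)"
proof -
  have "[2 ^ x = 2 ^ y :: int] (mod 3 ^ Suc n) \<longleftrightarrow> [2 ^ x = 2 ^ y :: nat] (mod 3 ^ Suc n)"
    using cong_int_iff[of "2 ^ x" "2 ^ y" "3 ^ Suc n"] by simp
  also have "\<dots> \<longleftrightarrow> [x = y] (mod ord (3 ^ Suc n) (2::nat))"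
    by (rule order_divides_expdiff) simp
  also have "ord (3 ^ Suc n) (2::nat) = 2 * 3 ^ n"
    using residue_primroot_2_power_3[of n] totient_power_3[of n] by (simp add: residue_primroot_def)
  finally show ?thesis .
qed

text \<open>A number prime to 3 is a unit modulo \<open>3 ^ Suc n\<close>, and the powers of 2 run
  through all units.\<close>

lemma discrete_log_2:
  fixes s :: int
  assumes "\<not> 3 dvd s"
  obtains x :: nat where "[2 ^ x = s] (mod 3 ^ Suc n)"
proof -
  define M :: nat where "M = 3 ^ Suc n"
  have M: "M > 1" unfolding M_def by (rule one_less_power) auto
  define t where "t = nat (s mod int M)"
  have t: "int t = s mod int M" using M by (simp add: t_def)
  have "coprime s (int M)"
    using assms prime_imp_coprime[of "3::int" s] by (simp add: M_def coprime_commute)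
  hence "coprime (s mod int M) (int M)"
    using M by (subst coprime_mod_left_iff) auto
  hence "coprime t M"
    by (metis t coprime_int_iff)
  moreover have "t < M" using t M
    by (metis of_nat_less_iff pos_mod_bound of_nat_0_less_iff less_trans zero_less_one)
  ultimately have "t \<in> totatives M"
    using M by (auto simp: totatives_def intro!: Nat.gr0I)
  moreover have "(\<lambda>i. 2 ^ i mod M) ` {..<totient M} = totatives M"
    using residue_primroot_is_generator[OF M] residue_primroot_2_power_3[of n]
    by (auto simp: M_def bij_betw_def)
  ultimately obtain x where "t = 2 ^ x mod M" by auto
  hence "[2 ^ x = s] (mod int M)"
    using t by (simp add: cong_def zmod_int)
  thus ?thesis using that by (simp add: M_def)
qed

section \<open>Undoing Collatz steps along a sequence of exponents\<close>

text \<open>The sum in (R) for \<open>\<kappa> = n - 1\<close>, over the integers. The empty case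
  \<open>n = 0\<close> is the base of the inductions that strip off one exponent at a time.\<close>

definition collatz_sum :: "(nat \<Rightarrow> nat) \<Rightarrow> nat \<Rightarrow> int" where
  "collatz_sum a n = (\<Sum>i<n. 2 ^ a i * 3 ^ (n - 1 - i))"

lemma collatz_sum_0 [simp]: "collatz_sum a 0 = 0"
  by (simp add: collatz_sum_def)

lemma collatz_sum_Suc: "collatz_sum a (Suc n) = 3 * collatz_sum a n + 2 ^ a n"
proof -
  have "(\<Sum>i<n. 2 ^ a i * 3 ^ (n - i)) = (3::int) * (\<Sum>i<n. 2 ^ a i * 3 ^ (n - 1 - i))"
    unfolding sum_distrib_left
  proof (intro sum.cong refl)
    fix i assume "i \<in> {..<n}"
    hence "n - i = Suc (n - 1 - i)" by auto
    thus "2 ^ a i * 3 ^ (n - i) = (3::int) * (2 ^ a i * 3 ^ (n - 1 - i))" by simp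
  qed
  thus ?thesis by (simp add: collatz_sum_def)
qed

lemma collatz_sum_cong:
  "(\<And>i. i < n \<Longrightarrow> a i = a' i) \<Longrightarrow> collatz_sum a n = collatz_sum a' n"
  by (auto simp: collatz_sum_def intro!: sum.cong)

text \<open>Modulo 3 only the last summand \<open>2 ^ a n\<close> survives, so 3 divides
  \<open>2 ^ d * z - 1\<close> for the last gap \<open>d\<close>. The quotient \<open>w\<close> is
  an inverse Collatz step from \<open>z\<close>, and the numerator splits off one factor 3.\<close>

lemma collatz_step:
  assumes "a n \<le> a (Suc n)" "3 ^ Suc n dvd 2 ^ a (Suc n) * z - collatz_sum a (Suc n)"
  obtains w where "2 ^ (a (Suc n) - a n) * z = 3 * w + 1"
    "2 ^ a (Suc n) * z - collatz_sum a (Suc n) = 3 * (2 ^ a n * w - collatz_sum a n)"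
proof -
  define d where "d = a (Suc n) - a n"
  have a: "a (Suc n) = a n + d" using assms(1) by (simp add: d_def)
  have eq: "2 ^ a (Suc n) * z - collatz_sum a (Suc n)
      = 2 ^ a n * (2 ^ d * z - 1) - 3 * collatz_sum a n"
    by (simp add: a collatz_sum_Suc power_add algebra_simps)
  have "3 dvd 2 ^ a (Suc n) * z - collatz_sum a (Suc n)"
    using assms(2) by (meson dvd_trans dvd_power zero_less_Suc)
  hence "3 dvd 2 ^ a n * (2 ^ d * z - 1)"
    unfolding eq by (metis dvd_diff_right_iff dvd_triv_left dvd_diff_left_iff)
  moreover have "coprime (3::int) (2 ^ a n)" by simp
  ultimately have "3 dvd 2 ^ d * z - 1" by (simp add: coprime_dvd_mult_right_iff)
  then obtain w where w: "2 ^ d * z - 1 = 3 * w" by (elim dvdE)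
  show ?thesis
  proof (rule that)
    show "2 ^ (a (Suc n) - a n) * z = 3 * w + 1" using w by (simp add: d_def)
    show "2 ^ a (Suc n) * z - collatz_sum a (Suc n) = 3 * (2 ^ a n * w - collatz_sum a n)"
      unfolding eq w by (simp add: algebra_simps)
  qed
qed

text \<open>Undoing the Collatz steps from the end \<open>z\<close> costs one factor 3 of the modulus per step, so
  only the residue of \<open>2 ^ (a (i + 1) - a i)\<close> modulo \<open>3 ^ (i + 1)\<close> matters.\<close>
lemma dvd_collatz_sum_cong:
  assumes "\<And>i. i < n \<Longrightarrow> a i \<le> a (Suc i)" "\<And>i. i < n \<Longrightarrow> a' i \<le> a' (Suc i)"
    and "\<And>i. i < n \<Longrightarrow> [a (Suc i) - a i = a' (Suc i) - a' i] (mod 2 * 3 ^ i)"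
    and "[z = z'] (mod 3 ^ n)"
    and "3 ^ n dvd 2 ^ a n * z - collatz_sum a n"
  shows "3 ^ n dvd 2 ^ a' n * z' - collatz_sum a' n"
  using assms
proof (induction n arbitrary: z z')
  case 0
  thus ?case by simp
next
  case (Suc n)
  let ?d = "a (Suc n) - a n" and ?d' = "a' (Suc n) - a' n"
  from Suc.prems obtain w where w: "2 ^ ?d * z = 3 * w + 1"
      "2 ^ a (Suc n) * z - collatz_sum a (Suc n) = 3 * (2 ^ a n * w - collatz_sum a n)"
    using collatz_step[of a n z] by blast
  have "[2 ^ ?d * z = 2 ^ ?d' * z'] (mod 3 ^ Suc n)"
    using Suc.prems(3)[of n] Suc.prems(4) by (intro cong_mult) (simp_all only: cong_power_2_iff lessI)
  then obtain t where t: "2 ^ ?d' * z' = 2 ^ ?d * z + 3 ^ Suc n * t"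
    by (metis cong_iff_lin cong_sym)
  \<comment> \<open>\<open>2 ^ ?d' * z'\<close> differs from \<open>3 * w + 1\<close> by
    \<open>3 ^ Suc n * t\<close>, so this \<open>w'\<close> is the predecessor of \<open>z'\<close>,
    and it agrees with \<open>w\<close> modulo \<open>3 ^ n\<close>.\<close>
  define w' where "w' = w + 3 ^ n * t"
  have w': "2 ^ ?d' * z' = 3 * w' + 1"
    using t w(1) by (simp add: w'_def algebra_simps)
  have "3 ^ n dvd 2 ^ a' n * w' - collatz_sum a' n"
  proof (rule Suc.IH)
    show "[w = w'] (mod 3 ^ n)" by (simp add: w'_def cong_iff_dvd_diff)
    show "3 ^ n dvd 2 ^ a n * w - collatz_sum a n"
      using Suc.prems(5) unfolding w(2) power_Suc dvd_mult_cancel_left by simp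
  qed (use Suc.prems in auto)
  moreover have "2 ^ a' (Suc n) * z' = 2 ^ a' n * (2 ^ ?d' * z')"
    using Suc.prems(2)[of n] by (simp flip: power_add mult.assoc)
  hence "2 ^ a' (Suc n) * z' - collatz_sum a' (Suc n) = 3 * (2 ^ a' n * w' - collatz_sum a' n)"
    unfolding w' by (simp add: collatz_sum_Suc algebra_simps)
  ultimately show ?case by (simp only: power_Suc dvd_mult_cancel_left) simp
qed

text \<open>A strict gap \<open>d\<close> gives \<open>2 ^ d * z \<ge> 2\<close>, so the predecessor
  \<open>(2 ^ d * z - 1) / 3\<close> is again positive. The induction runs from the end
  \<open>z\<close> back to \<open>m\<close>.\<close>

lemma collatz_preimage_pos:
  assumes "\<And>i. i < n \<Longrightarrow> a i < a (Suc i)" "z > 0"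
    and "3 ^ n * m = 2 ^ a n * z - collatz_sum a n"
  shows "m > 0"
  using assms
proof (induction n arbitrary: z)
  case 0
  thus ?case by simp
next
  case (Suc n)
  have "3 ^ Suc n dvd 2 ^ a (Suc n) * z - collatz_sum a (Suc n)"
    using Suc.prems(3) by (metis dvd_triv_left)
  then obtain w where w: "2 ^ (a (Suc n) - a n) * z = 3 * w + 1"
      "2 ^ a (Suc n) * z - collatz_sum a (Suc n) = 3 * (2 ^ a n * w - collatz_sum a n)"
    using collatz_step[of a n z] Suc.prems(1)[of n] by (metis lessI less_imp_le)
  have "(2::int) ^ 1 \<le> 2 ^ (a (Suc n) - a n)"
    using Suc.prems(1)[of n] by (intro power_increasing) auto
  hence "2 * 1 \<le> 2 ^ (a (Suc n) - a n) * z"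
    using Suc.prems(2) by (intro mult_mono) auto
  hence "w > 0" using w(1) by linarith
  moreover have "3 ^ n * m = 2 ^ a n * w - collatz_sum a n"
    using Suc.prems(3) unfolding w(2) by simp
  ultimately show ?case using Suc.IH Suc.prems(1) by (meson less_SucI)
qed

text \<open>All later exponents are positive, so only the summand \<open>2 ^ a 0 * 3 ^ n\<close> can
  be odd.\<close>

lemma even_collatz_sum_iff:
  assumes "\<And>i. i < n \<Longrightarrow> a i < a (Suc i)"
  shows "even (collatz_sum a (Suc n)) \<longleftrightarrow> a 0 > 0"
  using assms
proof (induction n)
  case 0
  thus ?case by (simp add: collatz_sum_Suc)
next
  case (Suc n)
  have "even (2 ^ a (Suc n) :: int)" using Suc.prems[of n] by simp
  moreover have "collatz_sum a (Suc (Suc n)) = 3 * collatz_sum a (Suc n) + 2 ^ a (Suc n)"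
    by (rule collatz_sum_Suc)
  ultimately show ?case using Suc.IH Suc.prems by simp
qed

text \<open>Modulo 2 the power of 3 is 1 and the top power of 2 vanishes, so \<open>m\<close> has
  the parity of the sum.\<close>

lemma odd_collatz_preimage_iff:
  assumes "\<And>i. i \<le> n \<Longrightarrow> a i < a (Suc i)"
    and "3 ^ Suc n * int m = 2 ^ a (Suc n) - collatz_sum a (Suc n)"
  shows "odd m \<longleftrightarrow> a 0 = 0"
proof -
  have "even (2 ^ a (Suc n) :: int)" using assms(1)[of n] by simp
  hence "odd m \<longleftrightarrow> odd (collatz_sum a (Suc n))"
    using arg_cong[OF assms(2), of odd] by simp
  thus ?thesis using even_collatz_sum_iff[of n a] assms(1) by simp
qed

text \<open>All summands but the last carry a factor 3. This makes \<open>discrete_log_2\<close>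
  applicable to the sum.\<close>

lemma not_3_dvd_collatz_sum: "\<not> 3 dvd collatz_sum a (Suc n)"
proof
  assume "3 dvd collatz_sum a (Suc n)"
  hence "3 dvd (2::int) ^ a n"
    by (simp add: collatz_sum_Suc dvd_add_right_iff)
  thus False
    using prime_dvd_power[of "3::int" 2 "a n"] by simp
qed

text \<open>The congruence modulo 9 forces \<open>2 ^ d * (2 ^ D - 1) \<equiv> 3\<close> for the last two gaps
  \<open>d\<close>, \<open>D\<close>, so \<open>2 ^ D\<close> is 1 modulo 3 but not modulo 9.\<close>
lemma last_gap_mod_6:
  assumes "a (Suc n) \<le> a (Suc (Suc n))" "a n \<le> a (Suc n)"
    and "9 dvd 2 ^ a (Suc (Suc n)) - collatz_sum a (Suc (Suc n))"
  shows "(a (Suc (Suc n)) - a (Suc n)) mod 6 \<in> {2, 4}"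
proof -
  define d D where "d = a (Suc n) - a n" and "D = a (Suc (Suc n)) - a (Suc n)"
  have a: "a (Suc n) = a n + d" "a (Suc (Suc n)) = a n + d + D"
    using assms by (auto simp: d_def D_def)
  have "2 ^ a (Suc (Suc n)) - collatz_sum a (Suc (Suc n))
      = 2 ^ a n * (2 ^ d * (2 ^ D - 1) - 3) - 9 * collatz_sum a n"
    by (simp add: a collatz_sum_Suc power_add algebra_simps)
  hence "9 dvd 2 ^ a n * (2 ^ d * (2 ^ D - 1) - 3 :: int)"
    using assms(3) by (metis dvd_diff_left_iff dvd_triv_left)
  moreover have "coprime (3 ^ 2 :: int) (2 ^ a n)" by (simp del: power_numeral)
  ultimately have *: "9 dvd (2 ^ d * (2 ^ D - 1) - 3 :: int)"
    by (simp add: coprime_dvd_mult_right_iff)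
  hence "3 dvd (2 ^ d * (2 ^ D - 1) - 3 :: int)" by (rule dvd_trans[rotated]) simp
  hence "3 dvd (2 ^ d * (2 ^ D - 1) :: int)" by (simp add: dvd_diff_left_iff)
  hence "3 dvd (2 ^ D - 1 :: int)" by (simp add: coprime_dvd_mult_right_iff)
  hence "[2 ^ D = 2 ^ 0 :: int] (mod 3 ^ Suc 0)" by (simp add: cong_iff_dvd_diff)
  hence "D mod 2 = 0" unfolding cong_power_2_iff by (simp add: cong_def)
  moreover have "D mod 6 \<noteq> 0"
  proof
    assume "D mod 6 = 0"
    \<comment> \<open>2 has order 6 modulo 9.\<close>
    hence "[2 ^ D = 2 ^ 0 :: int] (mod 3 ^ Suc (Suc 0))"
      unfolding cong_power_2_iff by (simp add: cong_def)
    hence "9 dvd (2 ^ D - 1 :: int)" by (simp add: cong_iff_dvd_diff)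
    hence "9 dvd (2 ^ d * (2 ^ D - 1) :: int)" by simp
    with * have "9 dvd (3::int)" by (metis dvd_diff_right_iff)
    thus False by simp
  qed
  ultimately have "D mod 6 \<in> {2, 4}" by (simp; presburger)
  thus ?thesis by (simp add: D_def)
qed


section \<open>Exponents and numerators of the formulas for \<open>E\<close> and
  \<open>O\<close>\<close>

text \<open>The exponents \<open>a\<^sub>0, \<dots>, a\<^sub>k\<^sub>+\<^sub>2\<close> of a representation (R) with \<open>\<kappa> = k + 1\<close>.\<close>
definition exps :: "nat \<Rightarrow> nat \<Rightarrow> (nat \<Rightarrow> nat) \<Rightarrow> (nat \<Rightarrow> nat) \<Rightarrow> nat \<Rightarrow> nat \<Rightarrow> nat" where
  "exps r k \<upsilon> b c i = (if i = 0 then 0 else if i \<le> k + 1 then mid_exp r \<upsilon> b (i - 1)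
     else top_exp r k \<upsilon> b c)"

text \<open>The integer numerator of \<open>sol\<close>, which turns integrality into
  divisibility.\<close>

definition numer :: "nat \<Rightarrow> nat \<Rightarrow> (nat \<Rightarrow> nat) \<Rightarrow> (nat \<Rightarrow> nat) \<Rightarrow> nat \<Rightarrow> int" where
  "numer r k \<upsilon> b c = 2 ^ exps r k \<upsilon> b c (k + 2) - collatz_sum (exps r k \<upsilon> b c) (k + 2)"

lemma exps_0 [simp]: "exps r k \<upsilon> b c 0 = 0"
  and exps_1: "exps r k \<upsilon> b c (Suc 0) = 2 * b 0 + r"
  and exps_Suc: "1 \<le> j \<Longrightarrow> j \<le> k \<Longrightarrow>
    exps r k \<upsilon> b c (Suc j) = exps r k \<upsilon> b c j + 2 * b j * 3 ^ j + \<upsilon> j"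
  and exps_top: "exps r k \<upsilon> b c (k + 2) = exps r k \<upsilon> b c (k + 1) + 2 * b (k + 1) * 3 ^ (k + 1) + c"
proof -
  assume j: "1 \<le> j" "j \<le> k"
  then obtain i where "j = Suc i" by (cases j) auto
  with j show "exps r k \<upsilon> b c (Suc j) = exps r k \<upsilon> b c j + 2 * b j * 3 ^ j + \<upsilon> j"
    by (simp add: exps_def mid_exp_def)
qed (simp_all add: exps_def mid_exp_def top_exp_def)

lemma exps_less_Suc:
  assumes "admissible k \<upsilon>" "r > 0" "c > 0" "i < k + 2"
  shows "exps r k \<upsilon> b c i < exps r k \<upsilon> b c (Suc i)"
proof -
  consider "i = 0" | "1 \<le> i" "i \<le> k" | "i = k + 1" using assms(4) by linarith
  thus ?thesis
  proof cases
    case 2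
    hence "\<upsilon> i > 0" using assms(1) by (auto simp: admissible_def Suc_le_eq)
    thus ?thesis using exps_Suc[OF 2] by simp
  qed (use assms exps_top[of r k \<upsilon> b c] in \<open>auto simp: exps_1\<close>)
qed

lemma sol_eq: "sol r k \<upsilon> b c = of_int (numer r k \<upsilon> b c) / 3 ^ (k + 2)"
proof -
  let ?a = "exps r k \<upsilon> b c"
  have "collatz_sum ?a (k + 2) = (\<Sum>i<Suc (Suc k). 2 ^ ?a i * 3 ^ (Suc k - i))"
    by (simp add: collatz_sum_def)
  \<comment> \<open>The summand \<open>i = 0\<close> is \<open>3 ^ (k + 1)\<close> and
    \<open>i = 1\<close> is \<open>3 ^ k * 2 ^ (2 * b 0 + r)\<close>; the others become the sum over
    \<open>j = i - 1\<close>.\<close>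
  also have "\<dots> = 3 ^ Suc k + (\<Sum>i<Suc k. 2 ^ ?a (Suc i) * 3 ^ (k - i))"
    by (subst sum.lessThan_Suc_shift) simp
  also have "\<dots> = 3 ^ Suc k + 2 ^ ?a (Suc 0) * 3 ^ k + (\<Sum>i<k. 2 ^ ?a (Suc (Suc i)) * 3 ^ (k - Suc i))"
    by (subst sum.lessThan_Suc_shift) simp
  also have "(\<Sum>i<k. 2 ^ ?a (Suc (Suc i)) * 3 ^ (k - Suc i)) =
      (\<Sum>j = 1..k. 2 ^ ?a (Suc j) * 3 ^ (k - j) :: int)"
    by (simp add: sum.atLeast1_atMost_eq)
  also have "\<dots> = (\<Sum>j = 1..k. 3 ^ (k - j) * 2 ^ mid_exp r \<upsilon> b j)"
    by (intro sum.cong) (auto simp: exps_def mult.commute)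
  finally show ?thesis
    unfolding sol_def numer_def by (simp add: exps_1 exps_def[of _ _ _ _ _ "Suc (Suc k)"] mult.commute)
qed

section \<open>Integrality and the choice of \<open>c\<close>\<close>

lemma sol_in_Ints_iff: "sol r k \<upsilon> b c \<in> \<int> \<longleftrightarrow> 3 ^ (k + 2) dvd numer r k \<upsilon> b c"
proof -
  have "sol r k \<upsilon> b c = of_int (numer r k \<upsilon> b c) / of_int (3 ^ (k + 2))"
    by (simp add: sol_eq)
  thus ?thesis by (simp only: of_int_div_of_int_in_Ints_iff) simp
qed

text \<open>Changing \<open>b i\<close> changes the gap after exponent \<open>i\<close> by a
  multiple of \<open>2 * 3 ^ i\<close>, the modulus in \<open>dvd_collatz_sum_cong\<close>.\<close>

lemma dvd_numer_cong:
  assumes "admissible k \<upsilon>" "r > 0" "c > 0" "3 ^ (k + 2) dvd numer r k \<upsilon> b c"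
  shows "3 ^ (k + 2) dvd numer r k \<upsilon> b' c"
proof -
  have "3 ^ (k + 2) dvd 2 ^ exps r k \<upsilon> b' c (k + 2) * 1 - collatz_sum (exps r k \<upsilon> b' c) (k + 2)"
  proof (rule dvd_collatz_sum_cong[where a = "exps r k \<upsilon> b c" and z = 1])
    fix i assume i: "i < k + 2"
    show "exps r k \<upsilon> b c i \<le> exps r k \<upsilon> b c (Suc i)" "exps r k \<upsilon> b' c i \<le> exps r k \<upsilon> b' c (Suc i)"
      using exps_less_Suc[OF assms(1-3) i] by (simp_all add: less_imp_le)
    consider "i = 0" | "1 \<le> i" "i \<le> k" | "i = k + 1" using i by linarith
    thus "[exps r k \<upsilon> b c (Suc i) - exps r k \<upsilon> b c i =
        exps r k \<upsilon> b' c (Suc i) - exps r k \<upsilon> b' c i] (mod 2 * 3 ^ i)"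
    proof cases
      case 1
      thus ?thesis by (simp add: exps_1 cong_def)
    next
      case 2
      have "[2 * b i * 3 ^ i + \<upsilon> i = 2 * b' i * 3 ^ i + \<upsilon> i] (mod 2 * 3 ^ i)"
        by (intro cong_add) (auto simp: cong_def mult_ac)
      thus ?thesis using exps_Suc[OF 2, of r \<upsilon>] by (simp add: add.assoc)
    next
      case 3
      have "[2 * b i * 3 ^ i + c = 2 * b' i * 3 ^ i + c] (mod 2 * 3 ^ i)"
        by (intro cong_add) (auto simp: cong_def mult_ac)
      thus ?thesis using 3 exps_top[of r k \<upsilon> _ c] by (simp add: add.assoc)
    qed
  qed (use assms(4) in \<open>simp_all add: numer_def\<close>)
  thus ?thesis by (simp add: numer_def)
qed

lemma sol_pos:
  assumes "admissible k \<upsilon>" "r > 0" "c > 0" "3 ^ (k + 2) dvd numer r k \<upsilon> b c"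
  shows "sol r k \<upsilon> b c > 0"
proof -
  from assms(4) obtain m where m: "numer r k \<upsilon> b c = 3 ^ (k + 2) * m" by (elim dvdE)
  have "m > 0"
  proof (rule collatz_preimage_pos)
    show "3 ^ (k + 2) * m = 2 ^ exps r k \<upsilon> b c (k + 2) * 1 - collatz_sum (exps r k \<upsilon> b c) (k + 2)"
      using m by (simp add: numer_def)
  qed (use exps_less_Suc[OF assms(1-3)] in auto)
  thus ?thesis by (simp add: sol_eq m)
qed

text \<open>The sum stops below the top exponent, the only one that contains \<open>c\<close>.
  Integrality thus becomes a discrete logarithm problem for \<open>c\<close>.\<close>

lemma dvd_numer_iff_cong:
  "3 ^ (k + 2) dvd numer r k \<upsilon> b c \<longleftrightarrow>
     [2 ^ (exps r k \<upsilon> b 0 (k + 2) + c) = collatz_sum (exps r k \<upsilon> b 0) (k + 2)] (mod 3 ^ (k + 2))"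
proof -
  have "collatz_sum (exps r k \<upsilon> b c) (k + 2) = collatz_sum (exps r k \<upsilon> b 0) (k + 2)"
    by (rule collatz_sum_cong) (auto simp: exps_def)
  moreover have "exps r k \<upsilon> b c (k + 2) = exps r k \<upsilon> b 0 (k + 2) + c"
    by (simp add: exps_def top_exp_def)
  ultimately show ?thesis by (simp add: numer_def cong_iff_dvd_diff)
qed

text \<open>Two solutions agree modulo the order \<open>2 * 3 ^ (k + 1)\<close> of 2, and
  \<open>c_range k\<close> lies below it.\<close>

lemma dvd_numer_c_unique:
  assumes "c \<in> c_range k" "c' \<in> c_range k"
    and "3 ^ (k + 2) dvd numer r k \<upsilon> b c" "3 ^ (k + 2) dvd numer r k \<upsilon> b c'"
  shows "c = c'"
proof -
  have "Suc (k + 1) = k + 2" by simp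
  note cong_power_2_iff' = cong_power_2_iff[of _ _ "k + 1", unfolded this]
  have "[2 ^ (exps r k \<upsilon> b 0 (k + 2) + c) = 2 ^ (exps r k \<upsilon> b 0 (k + 2) + c') :: int]
      (mod 3 ^ (k + 2))"
    using assms(3,4) unfolding dvd_numer_iff_cong by (blast intro: cong_trans cong_sym)
  hence "[c = c'] (mod 2 * 3 ^ (k + 1))"
    unfolding cong_power_2_iff' cong_add_lcancel_nat .
  moreover have "c < 2 * 3 ^ (k + 1)" "c' < 2 * 3 ^ (k + 1)"
    using assms(1,2) by (simp_all add: c_range_def)
  ultimately show ?thesis
    by (rule cong_less_modulus_unique_nat)
qed

text \<open>The part \<open>2 * b (k + 1) * 3 ^ (k + 1)\<close> of the last gap is a multiple of 6,
  so \<open>last_gap_mod_6\<close> determines \<open>c\<close> modulo 6 up to the two allowed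
  residues.\<close>

lemma c_range_of_last_gap:
  assumes "admissible k \<upsilon>" "3 ^ (k + 2) dvd numer r k \<upsilon> b c" "c < 2 * 3 ^ (k + 1)"
  shows "c \<in> c_range k"
proof -
  let ?a = "exps r k \<upsilon> b c"
  from assms(1) have k: "k \<ge> 1" by (simp add: admissible_def)
  have "(3::int) ^ 2 dvd 3 ^ (k + 2)" by (rule le_imp_power_dvd) simp
  hence "9 dvd 2 ^ ?a (k + 2) - collatz_sum ?a (k + 2)"
    using assms(2) unfolding numer_def by (auto intro: dvd_trans)
  \<comment> \<open>\<open>exps_less_Suc\<close> presupposes \<open>c > 0\<close>, which is not yet
    known; the weak inequalities come from \<open>exps_top\<close> and, as \<open>k \<ge> 1\<close>,
    from \<open>exps_Suc\<close>.\<close>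
  hence "(?a (Suc (Suc k)) - ?a (Suc k)) mod 6 \<in> {2, 4}"
    using exps_top[of r k \<upsilon> b c] exps_Suc[of k k r \<upsilon> b c] k by (intro last_gap_mod_6) auto
  moreover have "?a (Suc (Suc k)) - ?a (Suc k) = 6 * (b (k + 1) * 3 ^ k) + c"
    using exps_top[of r k \<upsilon> b c] by simp
  ultimately have "c mod 6 = 2 \<or> c mod 6 = 4" by simp
  moreover from this have "2 \<le> c" by presburger
  ultimately show ?thesis using assms(3) by (simp add: c_range_def)
qed

lemma dvd_numer_c_exists:
  assumes "admissible k \<upsilon>"
  obtains c where "c \<in> c_range k" "3 ^ (k + 2) dvd numer r k \<upsilon> (\<lambda>_. 0) c"
proof -
  define M where "M = (2 * 3 ^ (k + 1) :: nat)"
  define s where "s = exps r k \<upsilon> (\<lambda>_. 0) 0 (k + 2)"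
  have "M > 0" by (simp add: M_def)
  obtain x where x: "[2 ^ x = collatz_sum (exps r k \<upsilon> (\<lambda>_. 0) 0) (k + 2)] (mod 3 ^ Suc (k + 1))"
    using discrete_log_2[OF not_3_dvd_collatz_sum, of "exps r k \<upsilon> (\<lambda>_. 0) 0" "k + 1" "k + 1"] by auto
  \<comment> \<open>This is \<open>x - s\<close> modulo \<open>M\<close>; adding
    \<open>(M - 1) * s\<close> avoids subtraction of naturals.\<close>
  define c where "c = (x + (M - 1) * s) mod M"
  have "[s + c = s + (x + (M - 1) * s)] (mod M)"
    by (intro cong_add) (auto simp: c_def)
  also have "s + (x + (M - 1) * s) = x + M * s"
    using \<open>M > 0\<close> by (cases M) (auto simp: algebra_simps)
  also have "[x + M * s = x] (mod M)" by (simp add: cong_def)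
  finally have "[2 ^ (s + c) = 2 ^ x :: int] (mod 3 ^ Suc (k + 1))"
    unfolding cong_power_2_iff M_def .
  hence *: "3 ^ (k + 2) dvd numer r k \<upsilon> (\<lambda>_. 0) c"
    using x unfolding dvd_numer_iff_cong s_def by (auto intro: cong_trans)
  moreover have "c \<in> c_range k"
    using assms * \<open>M > 0\<close> by (intro c_range_of_last_gap) (auto simp: c_def M_def)
  ultimately show ?thesis using that by blast
qed

text \<open>Integral values are positive by \<open>sol_pos\<close>, and by
  \<open>dvd_numer_c_unique\<close> at most one \<open>c\<close> in the range gives an integral
  value, so that \<open>c\<close> attains the minimum.\<close>

lemma is_c_iff:
  assumes "admissible k \<upsilon>" "r > 0"
  shows "is_c r k \<upsilon> c \<longleftrightarrow> c \<in> c_range k \<and> 3 ^ (k + 2) dvd numer r k \<upsilon> (\<lambda>_. 0) c"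
proof -
  have "c \<in> c_range k \<and> sol r k \<upsilon> (\<lambda>_. 0) c \<in> \<int> \<and> sol r k \<upsilon> (\<lambda>_. 0) c > 0 \<longleftrightarrow>
      c \<in> c_range k \<and> 3 ^ (k + 2) dvd numer r k \<upsilon> (\<lambda>_. 0) c" for c
    using sol_pos[OF assms, of c "\<lambda>_. 0"] unfolding sol_in_Ints_iff by (auto simp: c_range_def)
  hence "is_c r k \<upsilon> c \<longleftrightarrow> (c \<in> c_range k \<and> 3 ^ (k + 2) dvd numer r k \<upsilon> (\<lambda>_. 0) c) \<and>
      \<not> (\<exists>c'. (c' \<in> c_range k \<and> 3 ^ (k + 2) dvd numer r k \<upsilon> (\<lambda>_. 0) c') \<and>
        sol r k \<upsilon> (\<lambda>_. 0) c' < sol r k \<upsilon> (\<lambda>_. 0) c)"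
    unfolding is_c_def is_arg_min_def by simp
  thus ?thesis by (metis dvd_numer_c_unique less_irrefl)
qed

lemma is_c_unique_exists:
  assumes "admissible k \<upsilon>" "r > 0"
  shows "\<exists>!c. is_c r k \<upsilon> c"
proof -
  obtain c where "c \<in> c_range k" "3 ^ (k + 2) dvd numer r k \<upsilon> (\<lambda>_. 0) c"
    using dvd_numer_c_exists[OF assms(1)] .
  thus ?thesis
    unfolding is_c_iff[OF assms] by (intro ex1I[of _ c]) (blast intro: dvd_numer_c_unique)+
qed

section \<open>The odd solutions of (R) and the sets \<open>E\<close> and \<open>O\<close>\<close>

lemma R_form_iff:
  "R_form m \<longleftrightarrow> (\<exists>n a. (\<forall>i\<le>n. a i < a (Suc i)) \<and>
     3 ^ Suc n * int m = 2 ^ a (Suc n) - collatz_sum a (Suc n))"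
proof -
  have "real m = (2 ^ a (n + 1) - (\<Sum>i = 0..n. 2 ^ a i * 3 ^ (n - i))) / 3 ^ (n + 1) \<longleftrightarrow>
      3 ^ Suc n * int m = 2 ^ a (Suc n) - collatz_sum a (Suc n)" for n a
  proof -
    have "(\<Sum>i = 0..n. 2 ^ a i * 3 ^ (n - i)) = real_of_int (collatz_sum a (Suc n))"
      by (simp add: collatz_sum_def atLeast0AtMost lessThan_Suc_atMost)
    hence "real m = (2 ^ a (n + 1) - (\<Sum>i = 0..n. 2 ^ a i * 3 ^ (n - i))) / 3 ^ (n + 1) \<longleftrightarrow>
        real_of_int (3 ^ Suc n * int m) = real_of_int (2 ^ a (Suc n) - collatz_sum a (Suc n))"
      by (simp add: eq_divide_eq mult.commute)
    thus ?thesis by (simp only: of_int_eq_iff)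
  qed
  thus ?thesis by (simp add: R_form_def)
qed

text \<open>Integrality passes from the zero sequence to \<open>b\<close> by
  \<open>dvd_numer_cong\<close>. Then \<open>exps\<close> is a sequence for (R), and it starts with
  0, which makes \<open>m\<close> odd.\<close>

lemma sol_set_odd_R_form:
  assumes "x \<in> sol_set r" "r > 0"
  obtains m :: nat where "odd m" "x = real m" "R_form m"
proof -
  from assms(1) obtain k \<upsilon> b c where x: "x = sol r k \<upsilon> b c" and adm: "admissible k \<upsilon>"
    and "is_c r k \<upsilon> c" by (auto simp: sol_set_def)
  hence c: "c \<in> c_range k" "3 ^ (k + 2) dvd numer r k \<upsilon> (\<lambda>_. 0) c"
    using is_c_iff[OF adm assms(2)] by auto
  from c(1) have "c > 0" by (auto simp: c_range_def)
  note adm' = adm assms(2) \<open>c > 0\<close>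
  let ?a = "exps r k \<upsilon> b c"
  have dvd: "3 ^ (k + 2) dvd numer r k \<upsilon> b c" using dvd_numer_cong[OF adm' c(2)] .
  have "x > 0" using sol_pos[OF adm' dvd] x by simp
  moreover have "x \<in> \<int>" using dvd x sol_in_Ints_iff by simp
  ultimately obtain m where m: "x = real m"
    by (metis Ints_cases of_int_0_less_iff of_nat_nat less_imp_le of_int_of_nat_eq)
  have "real_of_int (3 ^ (k + 2) * int m) = real_of_int (numer r k \<upsilon> b c)"
    using m x by (simp add: sol_eq field_simps)
  hence eq: "3 ^ Suc (k + 1) * int m = 2 ^ ?a (Suc (k + 1)) - collatz_sum ?a (Suc (k + 1))"
    unfolding of_int_eq_iff by (simp add: numer_def)
  have "R_form m"
    unfolding R_form_iff using exps_less_Suc[OF adm', of _ b] eq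
    by (intro exI[of _ "k + 1"] exI[of _ ?a] conjI allI impI) auto
  moreover have "odd m"
    using odd_collatz_preimage_iff[OF _ eq] exps_less_Suc[OF adm', of _ b] by simp
  ultimately show ?thesis using that m by blast
qed

text \<open>The representation is lengthened by running once more through the cycle 1, 4, 2, 1.\<close>
lemma collatz_preimage_extend:
  assumes "\<And>i. i < n \<Longrightarrow> a i < a (Suc i)" "3 ^ n * m = 2 ^ a n - collatz_sum a n"
  obtains a' where "\<And>i. i < Suc n \<Longrightarrow> a' i < a' (Suc i)"
    "3 ^ Suc n * m = 2 ^ a' (Suc n) - collatz_sum a' (Suc n)"
proof (rule that)
  \<comment> \<open>Since \<open>2 ^ (a n + 2) - 2 ^ a n = 3 * 2 ^ a n\<close>, the numerator is
    multiplied by exactly 3.\<close>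
  let ?a = "a(Suc n := a n + 2)"
  show "?a i < ?a (Suc i)" if "i < Suc n" for i
    using that assms(1)[of i] by (auto simp: less_Suc_eq)
  have "collatz_sum ?a n = collatz_sum a n" by (rule collatz_sum_cong) simp
  thus "3 ^ Suc n * m = 2 ^ ?a (Suc n) - collatz_sum ?a (Suc n)"
    using assms(2) by (simp add: collatz_sum_Suc algebra_simps)
qed

lemma exists_exps_eq:
  assumes "k \<ge> 1" "a 0 = 0" "\<And>i. i < k + 2 \<Longrightarrow> a i < a (Suc i)"
  obtains r \<upsilon> b c where "r \<in> {1, 2}" "admissible k \<upsilon>" "c < 2 * 3 ^ (k + 1)"
    "\<forall>i\<le>k + 2. exps r k \<upsilon> b c i = a i"
proof -
  define g where "g i = a (Suc i) - a i" for i
  have g: "a (Suc i) = a i + g i" "g i > 0" if "i < k + 2" for i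
    using assms(3)[OF that] by (simp_all add: g_def)
  \<comment> \<open>\<open>r\<close> and the \<open>\<upsilon> j\<close> are remainders counted from
    1, so their gaps are lowered by 1 before the division. \<open>c\<close> is an ordinary
    remainder, so the last gap is kept.\<close>
  define q where "q i = (if i \<le> k then g i - 1 else g i)" for i
  define b where "b i = q i div (2 * 3 ^ i)" for i
  define r where "r = q 0 mod 2 + 1"
  define \<upsilon> where "\<upsilon> j = q j mod (2 * 3 ^ j) + 1" for j
  define c where "c = q (k + 1) mod (2 * 3 ^ (k + 1))"
  have q: "q i = 2 * b i * 3 ^ i + q i mod (2 * 3 ^ i)" for i
    using div_mult_mod_eq[of "q i" "2 * 3 ^ i"] by (simp add: b_def mult_ac)
  have eq: "exps r k \<upsilon> b c (Suc i) = a (Suc i)" if "i \<le> k" for i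
    using that
  proof (induction i)
    case 0
    have "a (Suc 0) = q 0 + 1" using g[of 0] assms(2) by (simp add: q_def)
    thus ?case using q[of 0] by (simp add: exps_1 r_def)
  next
    case (Suc i)
    have "exps r k \<upsilon> b c (Suc (Suc i)) = exps r k \<upsilon> b c (Suc i) + (q (Suc i) + 1)"
      using exps_Suc[of "Suc i" k r \<upsilon> b c] q[of "Suc i"] Suc.prems by (simp add: \<upsilon>_def)
    also have "q (Suc i) + 1 = g (Suc i)" using g(2)[of "Suc i"] Suc.prems by (simp add: q_def)
    finally show ?case using g(1)[of "Suc i"] Suc by simp
  qed
  show ?thesis
  proof (rule that)
    show "r \<in> {1, 2}" by (auto simp: r_def)
    have "q j mod (2 * 3 ^ j) < 2 * 3 ^ j" for j by simp
    thus "admissible k \<upsilon>"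
      using assms(1) unfolding admissible_def \<upsilon>_def by (auto simp: Suc_le_eq)
    show "c < 2 * 3 ^ (k + 1)" by (simp add: c_def)
    show "\<forall>i\<le>k + 2. exps r k \<upsilon> b c i = a i"
    proof (intro allI impI)
      fix i assume "i \<le> k + 2"
      then consider "i = 0" | j where "i = Suc j" "j \<le> k" | "i = k + 2"
        by (cases i) (auto simp: le_Suc_eq)
      thus "exps r k \<upsilon> b c i = a i"
      proof cases
        case 3
        have "exps r k \<upsilon> b c (k + 2) = a (k + 1) + q (k + 1)"
          unfolding exps_top using eq[of k] q[of "k + 1"] by (simp add: c_def)
        also have "q (k + 1) = g (k + 1)" by (simp add: q_def)
        finally show ?thesis using 3 g(1)[of "k + 1"] by simp
      qed (use eq assms(2) in auto)
    qed
  qed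
qed

lemma odd_R_form_in_sol_set:
  assumes "odd m" "R_form m"
  obtains r where "r \<in> {1, 2}" "real m \<in> sol_set r"
proof -
  from assms(2) obtain n a0 where
      a0: "\<And>i. i < Suc n \<Longrightarrow> a0 i < a0 (Suc i)" "3 ^ Suc n * int m = 2 ^ a0 (Suc n) - collatz_sum a0 (Suc n)"
    unfolding R_form_iff less_Suc_eq_le by blast
  \<comment> \<open>Two extensions raise \<open>\<kappa>\<close> from \<open>n\<close> to
    \<open>n + 2\<close>, which is \<open>k + 1\<close> with \<open>k \<ge> 1\<close> even when
    \<open>n = 0\<close>.\<close>
  obtain a1 where a1: "\<And>i. i < Suc (Suc n) \<Longrightarrow> a1 i < a1 (Suc i)"
      "3 ^ Suc (Suc n) * int m = 2 ^ a1 (Suc (Suc n)) - collatz_sum a1 (Suc (Suc n))"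
    using collatz_preimage_extend[of "Suc n" a0 "int m", OF a0] by blast
  obtain a where a: "\<And>i. i < Suc (Suc (Suc n)) \<Longrightarrow> a i < a (Suc i)"
      "3 ^ Suc (Suc (Suc n)) * int m = 2 ^ a (Suc (Suc (Suc n))) - collatz_sum a (Suc (Suc (Suc n)))"
    using collatz_preimage_extend[of "Suc (Suc n)" a1 "int m", OF a1] by blast
  define k where "k = Suc n"
  have k: "k \<ge> 1" "Suc (Suc (Suc n)) = k + 2" by (simp_all add: k_def)
  note a = a[unfolded k(2)]
  have "a 0 = 0"
    using odd_collatz_preimage_iff[of "k + 1" a m] a assms(1) by simp
  then obtain r \<upsilon> b c where r: "r \<in> {1, 2}" and adm: "admissible k \<upsilon>" and c: "c < 2 * 3 ^ (k + 1)"
    and exps: "\<forall>i\<le>k + 2. exps r k \<upsilon> b c i = a i"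
    by (rule exists_exps_eq[where a = a, OF k(1) _ a(1)]) blast
  have "collatz_sum (exps r k \<upsilon> b c) (k + 2) = collatz_sum a (k + 2)"
    by (rule collatz_sum_cong) (simp add: exps)
  hence numer: "numer r k \<upsilon> b c = 3 ^ (k + 2) * int m"
    using a(2) by (simp only: numer_def exps order_refl)
  have c_range: "c \<in> c_range k"
    by (rule c_range_of_last_gap[OF adm _ c, of r b]) (simp add: numer)
  hence "c > 0" by (auto simp: c_range_def)
  have "r > 0" using r by auto
  \<comment> \<open>Divisibility is known for \<open>b\<close>, while \<open>is_c\<close> refers to
    the zero sequence; \<open>dvd_numer_cong\<close> transfers it.\<close>
  have "is_c r k \<upsilon> c"
    unfolding is_c_iff[OF adm \<open>r > 0\<close>]
    using c_range dvd_numer_cong[OF adm \<open>r > 0\<close> \<open>c > 0\<close>, of b] numer by (metis dvd_triv_left)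
  moreover have "real m = sol r k \<upsilon> b c" by (simp add: sol_eq numer)
  ultimately have "real m \<in> sol_set r" using adm by (auto simp: sol_set_def)
  thus ?thesis using that r by blast
qed

theorem theorem2:
  "(\<forall>k \<upsilon>. admissible k \<upsilon> \<longrightarrow> (\<exists>!c. is_c 1 k \<upsilon> c) \<and> (\<exists>!c. is_c 2 k \<upsilon> c)) \<and>
   (\<forall>x\<in>E_set \<union> O_set. \<exists>m::nat. odd m \<and> x = real m) \<and>
   (\<forall>m::nat. odd m \<longrightarrow> (R_form m \<longleftrightarrow> real m \<in> E_set \<union> O_set))"
proof (intro conjI allI impI ballI)
  show "\<exists>!c. is_c 1 k \<upsilon> c" "\<exists>!c. is_c 2 k \<upsilon> c" if "admissible k \<upsilon>" for k \<upsilon>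
    using is_c_unique_exists[OF that] by simp_all
next
  fix x assume "x \<in> E_set \<union> O_set"
  then obtain r where "x \<in> sol_set r" "r > 0" unfolding E_set_def O_set_def by fastforce
  thus "\<exists>m::nat. odd m \<and> x = real m" using sol_set_odd_R_form by metis
next
  fix m :: nat assume "odd m"
  show "R_form m \<longleftrightarrow> real m \<in> E_set \<union> O_set"
  proof
    assume "R_form m"
    with \<open>odd m\<close> obtain r where "r \<in> {1, 2}" "real m \<in> sol_set r"
      by (rule odd_R_form_in_sol_set)
    thus "real m \<in> E_set \<union> O_set" by (auto simp: E_set_def O_set_def)
  next
    assume "real m \<in> E_set \<union> O_set"
    then obtain r where "real m \<in> sol_set r" "r > 0" unfolding E_set_def O_set_def by fastforce
    thus "R_form m" using sol_set_odd_R_form by (metis of_nat_eq_iff)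
  qed
qed

end
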